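(* Let $\mathbf{F}=\mathbf{F}_{2^n}$ be a finite field of cardinality $2^n$. Let $E/\mathbf{F}$ be an elliptic curve given by $Y^2+a_1XY+a_3Y=X^3+a_2X^2+a_4X+a_6$, and assume that $E$ is ordinary, i.e. $a_1\ne 0$. Let $S(X_1,X_2,X_3)$ be the third summation polynomial for $E$. Let $P\in E(\mathbf{F})\setminus E(\mathbf{F})[2]$ and set $T=S(X_1,X_2,x(P))\in\mathbf{F}[X_1,X_2]/(X_1^{2^n}-X_1,X_2^{2^n}-X_2)$. Set $b=a_1(a_1x(P)+a_3)\in\mathbf{F}^*$. Let $\alpha_1,\ldots,\alpha_n$ be a basis of $\mathbf{F}$ over $\mathbf{F}_2$. Then in $R_2=\mathbf{F}_2[X_{ij}: i=1,2,\ j=1,\ldots,n]/(X_{ij}^2-X_{ij}: i=1,2,\ j=1,\ldots,n)$ one has $$\sum_{j=1}^n\mathrm{Tr}_{\mathbf{F}/\mathbf{F}_2}\left(\frac{\alpha_j}{b^2}\right)[T]_j=\mathrm{Tr}_{\mathbf{F}/\mathbf{F}_2}\left(\frac{x(P)+a_2}{a_1^2}\right)+\sum_{j=1}^n\mathrm{Tr}_{\mathbf{F}/\mathbf{F}_2}\left(\frac{\alpha_j}{a_1^2}\right)\cdot(X_{1j}+X_{2j}).$$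
   Context: $x(P)$ denotes the $x$-coordinate of a nonzero point $P$ in the given Weierstrass model. $E(\mathbf{F})[2]$ is the $2$-torsion subgroup (it contains $0$). Third summation polynomial: with $b_2=a_1^2+4a_2$, $b_4=a_1a_3+2a_4$, $b_6=a_3^2+4a_6$, $b_8=a_1^2a_6-a_1a_3a_4+a_2a_3^2+4a_2a_6-a_4^2$, $$S(X_1,X_2,X_3)=(X_1^2X_2^2+X_1^2X_3^2+X_2^2X_3^2)-2(X_1^2X_2X_3+X_1X_2^2X_3+X_1X_2X_3^2)-b_2X_1X_2X_3-b_4(X_1X_2+X_1X_3+X_2X_3)-b_6(X_1+X_2+X_3)-b_8.$$ Weil descent components: for $f\in\mathbf{F}[X_1,X_2]/(X_1^{2^n}-X_1,X_2^{2^n}-X_2)$, the elements $[f]_1,\ldots,[f]_n\in R_2$ are the unique ones such that $$f\Bigl(\sum_{j=1}^nX_{1j}\alpha_j,\ \sum_{j=1}^nX_{2j}\alpha_j\Bigr)=\sum_{i=1}^n[f]_i\,\alpha_i$$ in $\mathbf{F}[X_{ij}: i=1,2,\ j=1,\ldots,n]/(X_{ij}^2-X_{ij})$. *)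

theory Defs
  imports Complex_Main "HOL-Library.Poly_Mapping" "HOL-Library.Numeral_Type"
    "HOL-Computational_Algebra.Primes"
begin

section \<open>Polynomial rings in several variables\<close>

text \<open>The polynomial ring over \<^typ>\<open>'k\<close> whose variables are indexed by the type \<^typ>\<open>'v\<close>.\<close>

type_synonym ('v, 'k) mpoly = "('v \<Rightarrow>\<^sub>0 nat) \<Rightarrow>\<^sub>0 'k"

definition Var :: "'v \<Rightarrow> ('v, 'k::comm_ring_1) mpoly" where
  "Var v = Poly_Mapping.single (Poly_Mapping.single v 1) 1"

definition Const :: "'k \<Rightarrow> ('v, 'k::comm_ring_1) mpoly" where
  "Const c = Poly_Mapping.single 0 c"

text \<open>Substitution of \<open>f v\<close> for the variable \<open>v\<close>, where the coefficients are mapped to the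
  target ring by \<open>\<phi>\<close>.\<close>

definition monom_subst :: "('v \<Rightarrow> 'r) \<Rightarrow> ('v \<Rightarrow>\<^sub>0 nat) \<Rightarrow> 'r::comm_ring_1" where
  "monom_subst f m = (\<Prod>v\<in>Poly_Mapping.keys m. f v ^ Poly_Mapping.lookup m v)"

definition mpoly_subst ::
  "('k \<Rightarrow> 'r) \<Rightarrow> ('v \<Rightarrow> 'r) \<Rightarrow> ('v, 'k::comm_ring_1) mpoly \<Rightarrow> 'r::comm_ring_1" where
  "mpoly_subst \<phi> f p =
     (\<Sum>m\<in>Poly_Mapping.keys p. \<phi> (Poly_Mapping.lookup p m) * monom_subst f m)"

definition coeff_hom :: "('k::comm_ring_1 \<Rightarrow> 'r::comm_ring_1) \<Rightarrow> bool" where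
  "coeff_hom \<phi> \<longleftrightarrow> \<phi> 1 = 1 \<and> (\<forall>a b. \<phi> (a + b) = \<phi> a + \<phi> b) \<and> (\<forall>a b. \<phi> (a * b) = \<phi> a * \<phi> b)"

lemma coeff_homD:
  assumes "coeff_hom \<phi>"
  shows "\<phi> 0 = 0" "\<phi> 1 = 1" "\<phi> (a + b) = \<phi> a + \<phi> b" "\<phi> (a * b) = \<phi> a * \<phi> b"
proof -
  have "\<phi> 0 + \<phi> 0 = \<phi> (0 + 0)" using assms unfolding coeff_hom_def by metis
  then show "\<phi> 0 = 0" by simp
qed (use assms in \<open>auto simp: coeff_hom_def\<close>)

lemma coeff_hom_Const: "coeff_hom Const"
  by (simp add: coeff_hom_def Const_def single_add mult_single)

lemma monom_subst_superset:
  assumes "finite A" "Poly_Mapping.keys m \<subseteq> A"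
  shows "monom_subst f m = (\<Prod>v\<in>A. f v ^ Poly_Mapping.lookup m v)"
  unfolding monom_subst_def
  by (rule prod.mono_neutral_left) (use assms in \<open>auto simp: in_keys_iff\<close>)

lemma monom_subst_add: "monom_subst f (m + n) = monom_subst f m * monom_subst f n"
proof -
  let ?A = "Poly_Mapping.keys m \<union> Poly_Mapping.keys n"
  have "Poly_Mapping.keys (m + n) \<subseteq> ?A" by (rule Poly_Mapping.keys_add)
  then show ?thesis
    by (simp add: monom_subst_superset[of ?A] lookup_add power_add prod.distrib)
qed

lemma mpoly_subst_superset:
  assumes "coeff_hom \<phi>" "finite A" "Poly_Mapping.keys p \<subseteq> A"
  shows "mpoly_subst \<phi> f p = (\<Sum>m\<in>A. \<phi> (Poly_Mapping.lookup p m) * monom_subst f m)"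
  unfolding mpoly_subst_def
  by (rule sum.mono_neutral_left) (use assms in \<open>auto simp: in_keys_iff coeff_homD\<close>)

lemma mpoly_subst_add:
  assumes "coeff_hom \<phi>"
  shows "mpoly_subst \<phi> f (p + q) = mpoly_subst \<phi> f p + mpoly_subst \<phi> f q"
proof -
  let ?A = "Poly_Mapping.keys p \<union> Poly_Mapping.keys q"
  have "Poly_Mapping.keys (p + q) \<subseteq> ?A" by (rule Poly_Mapping.keys_add)
  then show ?thesis
    using assms by (simp add: mpoly_subst_superset[of \<phi> ?A] lookup_add coeff_homD
        distrib_right sum.distrib)
qed

lemma mpoly_subst_add':
  assumes "\<phi> 0 = 0" "\<And>a b. \<phi> (a + b) = \<phi> a + \<phi> b"
  shows "mpoly_subst \<phi> f (p + q) = mpoly_subst \<phi> f p + mpoly_subst \<phi> f q"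
proof -
  let ?A = "Poly_Mapping.keys p \<union> Poly_Mapping.keys q"
  have "mpoly_subst \<phi> f r = (\<Sum>m\<in>?A. \<phi> (Poly_Mapping.lookup r m) * monom_subst f m)"
    if "Poly_Mapping.keys r \<subseteq> ?A" for r
    unfolding mpoly_subst_def
    by (rule sum.mono_neutral_left) (use assms(1) that in \<open>auto simp: in_keys_iff\<close>)
  from this[of p] this[of q] this[of "p + q"] Poly_Mapping.keys_add[of p q] show ?thesis
    by (simp add: lookup_add assms(2) distrib_right sum.distrib)
qed


lemma mpoly_subst_single:
  "coeff_hom \<phi> \<Longrightarrow> mpoly_subst \<phi> f (Poly_Mapping.single m c) = \<phi> c * monom_subst f m"
  by (auto simp: mpoly_subst_def coeff_homD)

lemma mpoly_induct [case_names single add]: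
  assumes "\<And>m c. P (Poly_Mapping.single m c)" and "\<And>p q. P p \<Longrightarrow> P q \<Longrightarrow> P (p + q)"
  shows "P (p :: ('v, 'k::comm_ring_1) mpoly)"
proof (induction p rule: Poly_Mapping.update_induct)
  case const
  then show ?case using assms(1)[of 0 0] by simp
next
  case (update p m c)
  have "Poly_Mapping.update m c p = p + Poly_Mapping.single m c"
    using update by (intro poly_mapping_eqI)
      (auto simp: lookup_update lookup_add lookup_single when_def in_keys_iff)
  then show ?case using update assms by metis
qed

lemma mpoly_subst_mult:
  assumes h: "coeff_hom \<phi>"
  shows "mpoly_subst \<phi> f (p * q) = mpoly_subst \<phi> f p * mpoly_subst \<phi> f q"
proof (induction p rule: mpoly_induct)
  case (single m c)
  show ?case
  proof (induction q rule: mpoly_induct)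
    case (single n d)
    then show ?case
      using h by (simp add: mult_single mpoly_subst_single coeff_homD monom_subst_add)
  next
    case (add p q)
    then show ?case using h by (simp add: distrib_left mpoly_subst_add)
  qed
next
  case (add p q)
  then show ?case using h by (simp add: distrib_right mpoly_subst_add)
qed

lemma mpoly_subst_Var: "coeff_hom \<phi> \<Longrightarrow> mpoly_subst \<phi> f (Var v) = f v"
  by (simp add: Var_def mpoly_subst_single coeff_homD monom_subst_def)

lemma mpoly_subst_Const: "coeff_hom \<phi> \<Longrightarrow> mpoly_subst \<phi> f (Const c) = \<phi> c"
  by (simp add: Const_def mpoly_subst_single monom_subst_def)

lemma mpoly_subst_0: "mpoly_subst \<phi> f 0 = 0"
  by (simp add: mpoly_subst_def)

lemma mpoly_subst_diff:
  assumes "coeff_hom \<phi>"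
  shows "mpoly_subst \<phi> f (p - q) = mpoly_subst \<phi> f p - mpoly_subst \<phi> f q"
  using mpoly_subst_add[OF assms, of f "p - q" q] by simp

lemma mpoly_subst_power:
  assumes "coeff_hom \<phi>"
  shows "mpoly_subst \<phi> f (p ^ k) = mpoly_subst \<phi> f p ^ k"
proof (induction k)
  case 0
  show ?case using assms mpoly_subst_Const[OF assms, of f 1] by (simp add: Const_def coeff_homD)
qed (use assms in \<open>simp add: mpoly_subst_mult\<close>)


section \<open>Quotient rings\<close>

text \<open>A commutative ring is a module over itself, and the submodule spanned by a set is the ideal
  generated by it.\<close>

global_interpretation ideal: module "(*) :: 'r::comm_ring_1 \<Rightarrow> 'r \<Rightarrow> 'r"
  by standard (simp_all add: algebra_simps)

text \<open>The type \<open>('q, 'v, 'k) rpoly\<close> is the quotient of the polynomial ring over \<^typ>\<open>'k\<close>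
  in the variables \<open>X\<^sub>v\<close>, \<open>v :: 'v\<close>, by the ideal generated by all \<open>X\<^sub>v\<^bsup>q\<^esup> - X\<^sub>v\<close>
  where \<open>q\<close> is the cardinality of \<^typ>\<open>'q\<close>. The parameter \<^typ>\<open>'q\<close> is used only for its
  cardinality, so that one construction yields all three rings that are needed:
  \<open>('a, 2, 'a) rpoly\<close> is the ring \<open>F[X\<^sub>1,X\<^sub>2]\<close> modulo the \<open>X\<^sub>i\<^bsup>CARD(F)\<^esup> - X\<^sub>i\<close>;
  \<open>(gf2, 2 \<times> 'n, 'a) rpoly\<close> is \<open>F[X\<^sub>i\<^sub>j]\<close> modulo the \<open>X\<^sub>i\<^sub>j\<^sup>2 - X\<^sub>i\<^sub>j\<close>; and
  \<open>(gf2, 2 \<times> 'n, gf2) rpoly\<close> is \<open>R\<^sub>2\<close>. Note that \<open>1\<close> and \<open>2\<close> are the two distinct elements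
  of the type \<open>2\<close> (and \<open>2 = 0\<close> there).\<close>

definition red_ideal :: "'q itself \<Rightarrow> ('v, 'k::comm_ring_1) mpoly set" where
  "red_ideal _ = ideal.span (range (\<lambda>v. Var v ^ CARD('q) - Var v))"

definition red_rel :: "'q itself \<Rightarrow> ('v, 'k::comm_ring_1) mpoly \<Rightarrow> ('v, 'k) mpoly \<Rightarrow> bool" where
  "red_rel q p p' \<longleftrightarrow> p - p' \<in> red_ideal q"

lemma equivp_red_rel: "equivp (red_rel q)"
proof (rule equivpI)
  show "reflp (red_rel q)"
    by (auto intro: reflpI simp: red_rel_def red_ideal_def ideal.span_zero)
  show "symp (red_rel q)"
    unfolding symp_def red_rel_def red_ideal_def using ideal.span_neg by fastforce
  show "transp (red_rel q)"
  proof (rule transpI)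
    fix x y z
    assume "red_rel q x y" "red_rel q y z"
    then have "(x - y) + (y - z) \<in> red_ideal q"
      unfolding red_rel_def red_ideal_def by (rule ideal.span_add)
    then show "red_rel q x z" by (simp add: red_rel_def)
  qed
qed

lemma diff_diff_swap: "(a - b) - (c - d) = (a - c) - (b - d)" for a b c d :: "'a::ab_group_add"
  by (simp add: algebra_simps)

quotient_type (overloaded) ('q, 'v, 'k) rpoly =
  "('v \<Rightarrow>\<^sub>0 nat) \<Rightarrow>\<^sub>0 ('k::comm_ring_1)" / "red_rel TYPE('q)"
  by (rule equivp_red_rel)

lemma mpoly_subst_red_ideal:
  assumes "coeff_hom \<phi>" "\<And>v. f v ^ CARD('q) = f v" "p \<in> red_ideal TYPE('q)"
  shows "mpoly_subst \<phi> f p = 0"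
  using assms(3) unfolding red_ideal_def
  by (induction rule: ideal.span_induct_alt)
     (auto simp: mpoly_subst_0 mpoly_subst_add mpoly_subst_mult mpoly_subst_diff
          mpoly_subst_power mpoly_subst_Var assms(1,2))

lemma one_notin_red_ideal: "(1 :: ('v, 'k::comm_ring_1) mpoly) \<notin> red_ideal TYPE('q)"
proof
  have h: "coeff_hom (\<lambda>c::'k. c)" by (simp add: coeff_hom_def)
  assume "(1 :: ('v, 'k) mpoly) \<in> red_ideal TYPE('q)"
  then have "mpoly_subst (\<lambda>c::'k. c) (\<lambda>_::'v. 1) 1 = 0"
    by (intro mpoly_subst_red_ideal[where 'q = 'q]) (use h in auto)
  then show False using mpoly_subst_power[OF h, of "\<lambda>_::'v. 1" 0 0] by simp
qed

instantiation rpoly :: (type, type, comm_ring_1) comm_ring_1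
begin

lift_definition zero_rpoly :: "('a, 'b, 'c) rpoly" is 0 .
lift_definition one_rpoly :: "('a, 'b, 'c) rpoly" is 1 .
lift_definition plus_rpoly :: "('a, 'b, 'c) rpoly \<Rightarrow> ('a, 'b, 'c) rpoly \<Rightarrow> ('a, 'b, 'c) rpoly"
  is "(+)"
  unfolding red_rel_def red_ideal_def add_diff_add by (rule ideal.span_add)
lift_definition uminus_rpoly :: "('a, 'b, 'c) rpoly \<Rightarrow> ('a, 'b, 'c) rpoly" is uminus
  unfolding red_rel_def red_ideal_def minus_diff_minus by (rule ideal.span_neg)
lift_definition minus_rpoly :: "('a, 'b, 'c) rpoly \<Rightarrow> ('a, 'b, 'c) rpoly \<Rightarrow> ('a, 'b, 'c) rpoly"
  is "(-)"
proof -
  fix p p' q q' :: "('b, 'c) mpoly"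
  assume "red_rel TYPE('a) p p'" "red_rel TYPE('a) q q'"
  then have "(p - p') - (q - q') \<in> red_ideal TYPE('a)"
    unfolding red_rel_def red_ideal_def by (rule ideal.span_diff)
  then show "red_rel TYPE('a) (p - q) (p' - q')"
    unfolding red_rel_def diff_diff_swap .
qed
lift_definition times_rpoly :: "('a, 'b, 'c) rpoly \<Rightarrow> ('a, 'b, 'c) rpoly \<Rightarrow> ('a, 'b, 'c) rpoly"
  is "(*)"
proof -
  fix p p' q q' :: "('b, 'c) mpoly"
  assume "red_rel TYPE('a) p p'" "red_rel TYPE('a) q q'"
  then have "q * (p - p') + p' * (q - q') \<in> red_ideal TYPE('a)"
    unfolding red_rel_def red_ideal_def by (intro ideal.span_add ideal.span_scale)
  then show "red_rel TYPE('a) (p * q) (p' * q')"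
    unfolding red_rel_def right_diff_distrib by (simp add: mult.commute)
qed

instance
proof
  have "(0 :: ('b, 'c) mpoly) - 1 \<notin> red_ideal TYPE('a)"
  proof
    assume "(0 :: ('b, 'c) mpoly) - 1 \<in> red_ideal TYPE('a)"
    then have "- (0 - 1 :: ('b, 'c) mpoly) \<in> red_ideal TYPE('a)"
      unfolding red_ideal_def by (rule ideal.span_neg)
    then show False using one_notin_red_ideal[where 'v = 'b and 'k = 'c and 'q = 'a] by simp
  qed
  then show "(0 :: ('a, 'b, 'c) rpoly) \<noteq> 1"
    by transfer (simp only: red_rel_def not_False_eq_True)
next
  fix x y z :: "('a, 'b, 'c) rpoly"
  note refl = equivp_reflp[OF equivp_red_rel]
  show "x + y + z = x + (y + z)" by transfer (simp only: add.assoc refl)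
  show "x + y = y + x" by transfer (simp only: add.commute refl)
  show "0 + x = x" by transfer (simp only: add_0_left refl)
  show "- x + x = 0" by transfer (simp only: add.left_inverse refl)
  show "x - y = x + - y" by transfer (simp only: diff_conv_add_uminus refl)
  show "x * y * z = x * (y * z)" by transfer (simp only: mult.assoc refl)
  show "x * y = y * x" by transfer (simp only: mult.commute refl)
  show "1 * x = x" by transfer (simp only: mult_1_left refl)
  show "(x + y) * z = x * z + y * z" by transfer (simp only: distrib_right refl)
qed

end


lift_definition var :: "'v \<Rightarrow> ('q, 'v, 'k::comm_ring_1) rpoly" is Var .

lift_definition const :: "'k \<Rightarrow> ('q, 'v, 'k::comm_ring_1) rpoly" is Const .

lemma coeff_hom_const: "coeff_hom (const :: 'k \<Rightarrow> ('q, 'v, 'k::comm_ring_1) rpoly)"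
  unfolding coeff_hom_def const_def one_rpoly_def
  by (simp add: coeff_homD[OF coeff_hom_Const] plus_rpoly.abs_eq times_rpoly.abs_eq)

lemma abs_rpoly_eq_0_iff:
  "abs_rpoly p = (0 :: ('q, 'v, 'k::comm_ring_1) rpoly) \<longleftrightarrow> p \<in> red_ideal TYPE('q)"
  unfolding zero_rpoly_def rpoly.abs_eq_iff red_rel_def by simp

lemma var_power_card: "(var v :: ('q, 'v, 'k::comm_ring_1) rpoly) ^ CARD('q) = var v"
proof -
  have power: "abs_rpoly (p ^ k) = (abs_rpoly p :: ('q, 'v, 'k) rpoly) ^ k" for p k
    by (induction k) (simp_all only: power_0 power_Suc one_rpoly_def flip: times_rpoly.abs_eq)
  have "Var v ^ CARD('q) - Var v \<in> red_ideal TYPE('q)"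
    unfolding red_ideal_def by (intro ideal.span_base) auto
  then show ?thesis
    unfolding var.abs_eq power[symmetric] rpoly.abs_eq_iff red_rel_def .
qed

lemma const_power:
  "const (c ^ k) = (const c :: ('q, 'v, 'k::comm_ring_1) rpoly) ^ k"
  by (induction k) (simp_all add: coeff_homD[OF coeff_hom_const])

lemma abs_rpoly_conv_subst:
  "(abs_rpoly p :: ('q, 'v, 'k::comm_ring_1) rpoly) = mpoly_subst const var p"
proof (induction p rule: mpoly_induct)
  case (single m c)
  have "(abs_rpoly (Poly_Mapping.single m c) :: ('q, 'v, 'k) rpoly) = const c * monom_subst var m"
  proof (induction m arbitrary: c rule: Poly_Mapping.update_induct)
    case const
    then show ?case by (simp add: const.abs_eq Const_def monom_subst_def)
  next
    case (update m v k)
    have m: "Poly_Mapping.update v k m = m + Poly_Mapping.single v k"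
      using update by (intro poly_mapping_eqI)
        (auto simp: lookup_update lookup_add lookup_single when_def in_keys_iff)
    have power: "(abs_rpoly (Poly_Mapping.single (Poly_Mapping.single v k) 1) :: ('q, 'v, 'k) rpoly)
        = var v ^ k"
    proof (induction k)
      case 0
      show ?case by (simp add: one_rpoly_def)
    next
      case (Suc k)
      have "Poly_Mapping.single (Poly_Mapping.single v (Suc k)) 1 =
          (Var v * Poly_Mapping.single (Poly_Mapping.single v k) 1 :: ('v, 'k) mpoly)"
        by (simp add: Var_def mult_single flip: single_add)
      then show ?case using Suc by (simp add: var.abs_eq flip: times_rpoly.abs_eq)
    qed
    have "Poly_Mapping.single (m + Poly_Mapping.single v k) c =
        Poly_Mapping.single m c * Poly_Mapping.single (Poly_Mapping.single v k) 1"
      by (simp add: mult_single)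
    then have "(abs_rpoly (Poly_Mapping.single (Poly_Mapping.update v k m) c) :: ('q, 'v, 'k) rpoly)
        = const c * monom_subst var m * var v ^ k"
      by (simp only: m power update.IH flip: times_rpoly.abs_eq)
    moreover have "monom_subst var (Poly_Mapping.single v k) =
        (var v ^ k :: ('q, 'v, 'k) rpoly)"
      by (simp add: monom_subst_def)
    ultimately show ?case by (simp only: m monom_subst_add mult.assoc)
  qed
  then show ?case by (simp add: mpoly_subst_single coeff_hom_const)
next
  case (add p q)
  then show ?case by (simp add: mpoly_subst_add coeff_hom_const flip: plus_rpoly.abs_eq)
qed

lemma abs_rpoly_single:
  "(abs_rpoly (Poly_Mapping.single m c) :: ('q, 'v, 'k::comm_ring_1) rpoly) =
     const c * monom_subst var m"
  unfolding abs_rpoly_conv_subst by (rule mpoly_subst_single[OF coeff_hom_const])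

text \<open>Substitution into an element of the quotient ring. This is defined through a chosen
  representative; it does not depend on the choice as soon as \<open>\<phi>\<close> is a ring homomorphism and
  the \<open>f v\<close> satisfy the relations.\<close>

definition rpoly_subst ::
  "('k \<Rightarrow> 'r) \<Rightarrow> ('v \<Rightarrow> 'r) \<Rightarrow> ('q, 'v, 'k::comm_ring_1) rpoly \<Rightarrow> 'r::comm_ring_1" where
  "rpoly_subst \<phi> f F = mpoly_subst \<phi> f (rep_rpoly F)"

lemma rpoly_subst_abs:
  assumes "coeff_hom \<phi>" "\<And>v. f v ^ CARD('q) = f v"
  shows "rpoly_subst \<phi> f (abs_rpoly p :: ('q, 'v, 'k::comm_ring_1) rpoly) = mpoly_subst \<phi> f p"
proof -
  let ?p = "rep_rpoly (abs_rpoly p :: ('q, 'v, 'k) rpoly)"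
  have "red_rel TYPE('q) ?p p"
    by (metis Quotient3_rpoly Quotient3_abs_rep rpoly.abs_eq_iff)
  then have "mpoly_subst \<phi> f (?p - p) = 0"
    unfolding red_rel_def by (intro mpoly_subst_red_ideal[where 'q = 'q] assms)
  then show ?thesis
    unfolding rpoly_subst_def by (simp add: mpoly_subst_diff assms(1))
qed

lemma rpoly_subst_const:
  assumes "coeff_hom \<phi>" "\<And>v. f v ^ CARD('q) = f v"
  shows "rpoly_subst \<phi> f (const c :: ('q, 'v, 'k::comm_ring_1) rpoly) = \<phi> c"
  unfolding const.abs_eq by (simp add: rpoly_subst_abs assms mpoly_subst_Const)

lemma rpoly_subst_var:
  assumes "coeff_hom \<phi>" "\<And>v. f v ^ CARD('q) = f v"
  shows "rpoly_subst \<phi> f (var v :: ('q, 'v, 'k::comm_ring_1) rpoly) = f v"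
  unfolding var.abs_eq by (simp add: rpoly_subst_abs assms mpoly_subst_Var)


section \<open>Extensions of the field with two elements\<close>

text \<open>The map \<open>of_gf2\<close> is a ring homomorphism if \<^typ>\<open>'a\<close> has characteristic 2.\<close>

definition of_gf2 :: "gf2 \<Rightarrow> 'a::comm_ring_1" where
  "of_gf2 c = (if c = 0 then 0 else 1)"

lemma gf2_cases: "(c :: gf2) = 0 \<or> c = 1"
  by transfer auto

lemma CARD_gf2: "CARD(gf2) = 2"
proof -
  have "(UNIV :: gf2 set) = {0, 1}" using gf2_cases by auto
  then show ?thesis by (metis card_2_iff zero_neq_one)
qed

lemma coeff_hom_of_gf2:
  assumes "CHAR('a::comm_ring_1) = 2"
  shows "coeff_hom (of_gf2 :: gf2 \<Rightarrow> 'a)"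
proof -
  have two: "(1 :: 'a) + 1 = 0" using of_nat_CHAR[where 'a = 'a] assms by simp
  have two': "(1 :: gf2) + 1 = 0" by transfer simp
  have "of_gf2 (a + b) = (of_gf2 a + of_gf2 b :: 'a)"
    and "of_gf2 (a * b) = (of_gf2 a * of_gf2 b :: 'a)" for a b
    using gf2_cases[of a] gf2_cases[of b] two two' by (auto simp: of_gf2_def)
  then show ?thesis by (simp add: coeff_hom_def of_gf2_def)
qed

definition gf2_scale :: "gf2 \<Rightarrow> 'a::comm_ring_1 \<Rightarrow> 'a" where
  "gf2_scale c x = of_gf2 c * x"

definition gf2_basis :: "('n \<Rightarrow> 'a::comm_ring_1) \<Rightarrow> bool" where
  "gf2_basis \<alpha> \<longleftrightarrow> inj \<alpha> \<and> \<not> module.dependent gf2_scale (range \<alpha>)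
     \<and> module.span gf2_scale (range \<alpha>) = UNIV"

lemma gf2_vector_space:
  assumes "CHAR('a::field) = 2"
  shows "vector_space (gf2_scale :: gf2 \<Rightarrow> 'a \<Rightarrow> 'a)"
proof
  note h = coeff_homD[OF coeff_hom_of_gf2[OF assms]]
  fix a b :: gf2 and x y :: 'a
  show "gf2_scale a (x + y) = gf2_scale a x + gf2_scale a y"
    by (simp only: gf2_scale_def distrib_left)
  show "gf2_scale (a + b) x = gf2_scale a x + gf2_scale b x"
    by (simp only: gf2_scale_def h distrib_right)
  show "gf2_scale a (gf2_scale b x) = gf2_scale (a * b) x"
    by (simp only: gf2_scale_def h mult.assoc)
  show "gf2_scale 1 x = x"
    by (simp only: gf2_scale_def h mult_1_left)
qed

lemma gf2_basis_coordinates: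
  fixes \<alpha> :: "'n::finite \<Rightarrow> 'a::field"
  assumes char: "CHAR('a) = 2" and "gf2_basis \<alpha>"
  obtains c :: "'n \<Rightarrow> 'a \<Rightarrow> gf2"
  where "\<And>x. x = (\<Sum>i\<in>UNIV. of_gf2 (c i x) * \<alpha> i)"
    and "\<And>i u. c i (\<Sum>j\<in>UNIV. of_gf2 (u j) * \<alpha> j) = u i"
proof -
  interpret V: vector_space "gf2_scale :: gf2 \<Rightarrow> 'a \<Rightarrow> 'a"
    by (rule gf2_vector_space[OF char])
  have inj: "inj \<alpha>" and ind: "\<not> V.dependent (range \<alpha>)" and sp: "V.span (range \<alpha>) = UNIV"
    using assms(2) by (simp_all add: gf2_basis_def)
  have eq: "V.representation (range \<alpha>) (\<Sum>j\<in>UNIV. of_gf2 (u j) * \<alpha> j) (\<alpha> i) = u i" for u i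
  proof -
    have "V.representation (range \<alpha>) (\<Sum>j\<in>UNIV. gf2_scale (u j) (\<alpha> j)) (\<alpha> i)
        = (\<Sum>j\<in>UNIV. u j * V.representation (range \<alpha>) (\<alpha> j) (\<alpha> i))"
      using ind sp by (simp add: V.representation_sum V.representation_scale)
    also have "\<dots> = (\<Sum>j\<in>UNIV. if j = i then u j else 0)"
      using ind inj by (intro sum.cong) (auto simp: V.representation_basis inj_eq)
    finally show ?thesis by (simp add: gf2_scale_def)
  qed
  have "x = (\<Sum>i\<in>UNIV. of_gf2 (V.representation (range \<alpha>) x (\<alpha> i)) * \<alpha> i)" for x
  proof -
    have "(\<Sum>b\<in>range \<alpha>. gf2_scale (V.representation (range \<alpha>) x b) b) = x"
      using ind sp by (intro V.sum_representation_eq) auto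
    then show ?thesis using inj by (simp add: sum.reindex gf2_scale_def)
  qed
  then show ?thesis using eq by (intro that[of "\<lambda>i x. V.representation (range \<alpha>) x (\<alpha> i)"])
qed

text \<open>The trace of an extension of degree \<open>n\<close> of the field with two elements: the sum of the
  conjugates \<open>x\<close>, \<open>x\<^sup>2\<close>, \<open>x\<^sup>4\<close>, \<dots>, viewed as an element of \<^typ>\<open>gf2\<close>.\<close>

definition gf2_degree :: "'a::finite_field itself \<Rightarrow> nat" where
  "gf2_degree _ = (THE n. CARD('a) = 2 ^ n)"

definition gf2_trace :: "'a::finite_field \<Rightarrow> gf2" where
  "gf2_trace x = (THE t. of_gf2 t = (\<Sum>k<gf2_degree TYPE('a). x ^ (2 ^ k)))"

lemma CHAR_eq_2:
  assumes "CARD('a::finite_field) = 2 ^ n"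
  shows "CHAR('a) = 2"
proof -
  have "card {0, 1 :: 'a} \<le> CARD('a)" by (rule card_mono) auto
  then have "n > 0" using assms by (cases n) auto
  then have "(- 1 :: 'a) ^ CARD('a) = 1" unfolding assms by simp
  then have "- 1 = (1 :: 'a)" using finite_field_power_card_eq_same[of "- 1 :: 'a"] by simp
  then have "of_nat 2 = (0 :: 'a)" by (metis add.right_inverse of_nat_numeral one_add_one)
  then have "CHAR('a) dvd 2" by (simp only: of_nat_eq_0_iff_char_dvd)
  then show ?thesis using CHAR_prime[where 'a = 'a] primes_dvd_imp_eq two_is_prime_nat by blast
qed

lemma of_gf2_gf2_trace:
  fixes x :: "'a::finite_field"
  assumes card: "CARD('a) = 2 ^ n"
  shows "of_gf2 (gf2_trace x) = (\<Sum>k<n. x ^ (2 ^ k))"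
proof -
  let ?s = "\<Sum>k<n. x ^ (2 ^ k)"
  have deg: "gf2_degree TYPE('a) = n"
    unfolding gf2_degree_def card by (rule the_equality) auto
  have char: "CHAR('a) = 2" by (rule CHAR_eq_2[OF card])
  have "?s ^ 2 = (\<Sum>k<n. (x ^ (2 ^ k)) ^ 2)"
    by (rule freshmans_dream_sum) (simp_all only: char two_is_prime_nat)
  also have "\<dots> = (\<Sum>k<n. x ^ (2 ^ Suc k))"
    by (simp only: power_Suc2 power_mult)
  also have "\<dots> + x = ?s + x ^ (2 ^ n)"
    using sum.lessThan_Suc_shift[of "\<lambda>k. x ^ (2 ^ k)" n]
    by (simp only: sum.lessThan_Suc power_0 power_one_right add.commute)
  finally have "?s ^ 2 + x = ?s + x"
    using finite_field_power_card_eq_same[of x] by (simp only: card)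
  then have "?s ^ 2 = ?s" by (rule add_right_imp_eq)
  then have "?s * (?s - 1) = 0" by (simp only: power2_eq_square right_diff_distrib mult_1_right diff_self)
  then have "?s = 0 \<or> ?s = 1" by (simp only: mult_eq_0_iff right_minus_eq)
  then have "\<exists>t. of_gf2 t = ?s" unfolding of_gf2_def by (metis zero_neq_one)
  moreover have "t = t'" if "of_gf2 t = (of_gf2 t' :: 'a)" for t t'
    using that gf2_cases[of t] gf2_cases[of t'] by (auto simp: of_gf2_def)
  ultimately have "\<exists>!t. of_gf2 t = ?s" by metis
  then show ?thesis unfolding gf2_trace_def deg by (rule theI')
qed


section \<open>Weil descent\<close>

text \<open>The element \<open>f(\<Sum>\<^sub>j X\<^sub>1\<^sub>j \<alpha>\<^sub>j, \<Sum>\<^sub>j X\<^sub>2\<^sub>j \<alpha>\<^sub>j)\<close>.\<close>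

definition weil_subst ::
  "('n::finite \<Rightarrow> 'a::finite_field) \<Rightarrow> ('a, 2, 'a) rpoly \<Rightarrow> (gf2, 2 \<times> 'n, 'a) rpoly" where
  "weil_subst \<alpha> f = rpoly_subst const (\<lambda>i. \<Sum>j\<in>UNIV. var (i, j) * const (\<alpha> j)) f"

lemma idempotent_power:
  fixes a b e :: "'r::comm_ring_1"
  assumes "e * e = e" "k > 0"
  shows "((1 - e) * a + e * b) ^ k = (1 - e) * a ^ k + e * b ^ k"
  using assms(2)
proof (induction k rule: nat_induct_non_zero)
  case (Suc k)
  have h: "(1 - e) * (1 - e) = 1 - e" "e * (1 - e) = 0"
    using assms(1) by (simp_all add: algebra_simps)
  have "((1 - e) * a + e * b) ^ Suc k = ((1 - e) * a + e * b) * ((1 - e) * a ^ k + e * b ^ k)"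
    using Suc by simp
  also have "\<dots> = (1 - e) * (1 - e) * (a * a ^ k) + e * (1 - e) * (a * b ^ k + b * a ^ k)
      + e * e * (b * b ^ k)"
    by (simp only: algebra_simps)
  also have "\<dots> = (1 - e) * a ^ Suc k + e * b ^ Suc k"
    by (simp only: h assms(1)) simp
  finally show ?case .
qed simp

text \<open>The sums substituted in \<open>weil_subst\<close> satisfy the relations.\<close>

lemma weil_sum_power_card:
  fixes \<alpha> :: "'n::finite \<Rightarrow> 'a::finite_field"
  shows "(\<Sum>j\<in>UNIV. var (i, j) * const (\<alpha> j) :: (gf2, 2 \<times> 'n, 'a) rpoly) ^ CARD('a) =
         (\<Sum>j\<in>UNIV. var (i, j) * const (\<alpha> j))"
proof -
  let ?Q = "\<lambda>x :: (gf2, 2 \<times> 'n, 'a) rpoly. x ^ CARD('a) = x"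
  have "?Q (const c + (\<Sum>j\<in>A. var (i, j) * const (\<alpha> j)))" if "finite A" for A c
    using that
  proof (induction A arbitrary: c rule: finite_induct)
    case empty
    show ?case by (simp add: finite_field_power_card_eq_same flip: const_power)
  next
    case (insert j A)
    let ?e = "var (i, j) :: (gf2, 2 \<times> 'n, 'a) rpoly"
    let ?s = "\<Sum>j\<in>A. var (i, j) * const (\<alpha> j) :: (gf2, 2 \<times> 'n, 'a) rpoly"
    have e: "?e * ?e = ?e"
      using var_power_card[where 'q = gf2, of "(i, j)"] by (simp add: CARD_gf2 power2_eq_square)
    have "const c + (\<Sum>j\<in>insert j A. var (i, j) * const (\<alpha> j)) =
        (1 - ?e) * (const c + ?s) + ?e * (const (c + \<alpha> j) + ?s)"
      using insert by (simp add: coeff_homD[OF coeff_hom_const] algebra_simps)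
    then show ?case
      using idempotent_power[OF e, of "CARD('a)"] insert.IH by simp
  qed
  from this[of UNIV 0] show ?thesis by (simp add: coeff_homD[OF coeff_hom_const])
qed

lemma weil_subst_abs:
  "weil_subst \<alpha> (abs_rpoly p) =
     mpoly_subst const (\<lambda>i. \<Sum>j\<in>UNIV. var (i, j) * const (\<alpha> j)) p"
  unfolding weil_subst_def by (intro rpoly_subst_abs coeff_hom_const weil_sum_power_card)

text \<open>The canonical map from \<open>R\<^sub>2\<close> to its extension of scalars.\<close>

definition extend_scalars ::
  "(gf2, 'v, gf2) rpoly \<Rightarrow> (gf2, 'v, 'a::finite_field) rpoly" where
  "extend_scalars g = rpoly_subst (\<lambda>c. const (of_gf2 c)) var g"

lemma coeff_hom_const_of_gf2:
  assumes "CHAR('a::finite_field) = 2"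
  shows "coeff_hom (\<lambda>c. const (of_gf2 c :: 'a) :: ('q, 'v, 'a) rpoly)"
  unfolding coeff_hom_def
  by (simp only: coeff_homD[OF coeff_hom_of_gf2[OF assms]] coeff_homD[OF coeff_hom_const]) simp

lemma extend_scalars_abs:
  assumes "CHAR('a::finite_field) = 2"
  shows "(extend_scalars (abs_rpoly p) :: (gf2, 'v, 'a) rpoly) =
     mpoly_subst (\<lambda>c. const (of_gf2 c)) var p"
  unfolding extend_scalars_def
  by (intro rpoly_subst_abs coeff_hom_const_of_gf2 assms var_power_card)

text \<open>Every element of \<open>F[X\<^sub>i\<^sub>j]\<close> modulo the \<open>X\<^sub>i\<^sub>j\<^sup>2 - X\<^sub>i\<^sub>j\<close> has unique
  coordinates in \<open>R\<^sub>2\<close>, so the description in \<open>weil_component\<close> is a proper one.\<close>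

lemma ex1_weil_component:
  fixes \<alpha> :: "'n::finite \<Rightarrow> 'a::finite_field" and r :: "(gf2, 'v, 'a) rpoly"
  assumes char: "CHAR('a) = 2" and basis: "gf2_basis \<alpha>"
  shows "\<exists>!g. r = (\<Sum>i\<in>UNIV. extend_scalars (g i) * const (\<alpha> i))"
proof -
  obtain c where c1: "\<And>x. x = (\<Sum>i\<in>UNIV. of_gf2 (c i x) * \<alpha> i)"
    and c2: "\<And>i u. c i (\<Sum>j\<in>UNIV. of_gf2 (u j) * \<alpha> j) = u i"
    using gf2_basis_coordinates[OF assms] by blast
  note h = coeff_homD[OF coeff_hom_of_gf2[OF char]] and hc = coeff_homD[OF coeff_hom_const]
  note hh = coeff_hom_const_of_gf2[OF char]
  have c_add: "c i (x + y) = c i x + c i y" for i x y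
  proof -
    have "x + y = (\<Sum>i\<in>UNIV. of_gf2 (c i x + c i y) * \<alpha> i)"
      using c1[of x] c1[of y] by (simp add: h distrib_right sum.distrib)
    then show ?thesis using c2 by metis
  qed
  have c_0: "c i 0 = 0" for i
  proof -
    have "c i 0 + c i 0 = c i 0 + 0" by (simp only: add_0_right flip: c_add)
    then show ?thesis by (rule add_left_imp_eq)
  qed
  have c_scale: "c i (of_gf2 t * x) = t * c i x" for i t x
  proof -
    have "of_gf2 t * x = (\<Sum>i\<in>UNIV. of_gf2 (t * c i x) * \<alpha> i)"
      using arg_cong[OF c1[of x], of "\<lambda>z. of_gf2 t * z"]
      by (simp only: h sum_distrib_left mult.assoc)
    then show ?thesis using c2 by metis
  qed
  have c_basis: "c i (\<alpha> j) = (if i = j then 1 else 0)" for i j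
  proof -
    have "\<alpha> j = (\<Sum>k\<in>UNIV. of_gf2 (if k = j then 1 else 0) * \<alpha> k)"
    proof -
      have "(\<Sum>k\<in>UNIV. of_gf2 (if k = j then 1 else 0) * \<alpha> k) = (\<Sum>k\<in>UNIV. if k = j then \<alpha> k else 0)"
        by (intro sum.cong) (simp_all add: of_gf2_def)
      then show ?thesis by (simp only: sum.delta finite_UNIV if_True UNIV_I finite)
    qed
    then show ?thesis using c2[of i "\<lambda>k. if k = j then 1 else 0"] by simp
  qed
  define D :: "'n \<Rightarrow> ('v, 'a) mpoly \<Rightarrow> (gf2, 'v, gf2) rpoly"
    where "D i = mpoly_subst (\<lambda>x. const (c i x)) var" for i
  have D_0: "D i 0 = 0" for i
    by (simp add: D_def mpoly_subst_def)
  have D_add: "D i (p + q) = D i p + D i q" for i p q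
    unfolding D_def by (rule mpoly_subst_add') (simp_all add: c_add c_0 hc)
  have D_diff: "D i (p - q) = D i p - D i q" for i p q
    using D_add[of i "p - q" q] by (simp only: diff_add_cancel) (simp only: add_diff_cancel_right')
  have D_single: "D i (Poly_Mapping.single m x) = const (c i x) * monom_subst var m" for i m x
    by (auto simp: D_def mpoly_subst_def c_0 hc)
  have D_ideal: "D i p = 0" if "p \<in> red_ideal TYPE(gf2)" for i p
    using that unfolding red_ideal_def
  proof (induction rule: ideal.span_induct_alt)
    case (step a x y)
    then obtain v where x: "x = Var v * Var v - Var v"
      by (auto simp: CARD_gf2 power2_eq_square)
    have vv: "var v * var v = (var v :: (gf2, 'v, gf2) rpoly)"
      using var_power_card[where 'q = gf2, of v] by (simp add: CARD_gf2 power2_eq_square)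
    have "D i (a * x) = 0"
    proof (induction a rule: mpoly_induct)
      case (single m t)
      have s: "monom_subst var (Poly_Mapping.single v 1) = (var v :: (gf2, 'v, gf2) rpoly)"
        by (simp add: monom_subst_def)
      show ?case
        unfolding x Var_def right_diff_distrib D_diff mult_single mult_1_right
        by (simp only: D_single monom_subst_add s vv) simp
    next
      case (add p q)
      then show ?case by (simp add: distrib_right D_add)
    qed
    then show ?case using step by (simp add: D_add)
  qed (rule D_0)
  have ext_add: "extend_scalars (g + g') = (extend_scalars g + extend_scalars g' :: (gf2, 'v, 'a) rpoly)"
    for g g'
  proof (induction g rule: rpoly.abs_induct, induction g' rule: rpoly.abs_induct)
    fix p q
    show "extend_scalars (abs_rpoly p + abs_rpoly q) =
        (extend_scalars (abs_rpoly p) + extend_scalars (abs_rpoly q) :: (gf2, 'v, 'a) rpoly)"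
      unfolding plus_rpoly.abs_eq extend_scalars_abs[OF char] by (rule mpoly_subst_add[OF hh])
  qed
  have ext_single: "extend_scalars (abs_rpoly (Poly_Mapping.single m t)) =
      (const (of_gf2 t) * monom_subst var m :: (gf2, 'v, 'a) rpoly)" for m t
    unfolding extend_scalars_abs[OF char] by (rule mpoly_subst_single[OF hh])
  have lift: "\<exists>p. abs_rpoly p = (extend_scalars g :: (gf2, 'v, 'a) rpoly) \<and>
      (\<forall>a k. D k (p * Const a) = g * const (c k a))" for g
  proof (induction g rule: rpoly.abs_induct)
    fix u
    show "\<exists>p. abs_rpoly p = (extend_scalars (abs_rpoly u) :: (gf2, 'v, 'a) rpoly) \<and>
      (\<forall>a k. D k (p * Const a) = abs_rpoly u * const (c k a))"
    proof (induction u rule: mpoly_induct)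
      case (single m t)
      have "D k (Poly_Mapping.single m (of_gf2 t) * Const a) =
          abs_rpoly (Poly_Mapping.single m t) * const (c k a)" for a k
        by (simp only: Const_def mult_single add_0_right D_single c_scale abs_rpoly_single hc)
           (simp only: mult_ac)
      moreover have "abs_rpoly (Poly_Mapping.single m (of_gf2 t)) =
          (extend_scalars (abs_rpoly (Poly_Mapping.single m t)) :: (gf2, 'v, 'a) rpoly)"
        unfolding ext_single by (rule abs_rpoly_single)
      ultimately show ?case by blast
    next
      case (add u v)
      then obtain p q where
        "abs_rpoly p = (extend_scalars (abs_rpoly u) :: (gf2, 'v, 'a) rpoly)"
        "\<forall>a k. D k (p * Const a) = abs_rpoly u * const (c k a)"
        "abs_rpoly q = (extend_scalars (abs_rpoly v) :: (gf2, 'v, 'a) rpoly)"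
        "\<forall>a k. D k (q * Const a) = abs_rpoly v * const (c k a)" by blast
      then show ?case
        by (intro exI[of _ "p + q"] conjI allI)
           (simp_all only: distrib_right D_add ext_add flip: plus_rpoly.abs_eq)
    qed
  qed
  have "\<exists>g. r = (\<Sum>i\<in>UNIV. extend_scalars (g i) * const (\<alpha> i))"
  proof (induction r rule: rpoly.abs_induct)
    fix p
    show "\<exists>g. abs_rpoly p = (\<Sum>i\<in>UNIV. extend_scalars (g i) * const (\<alpha> i) :: (gf2, 'v, 'a) rpoly)"
    proof (induction p rule: mpoly_induct)
      case (single m x)
      have "(\<Sum>i\<in>UNIV. extend_scalars (abs_rpoly (Poly_Mapping.single m (c i x))) * const (\<alpha> i)) =
          (\<Sum>i\<in>UNIV. const (of_gf2 (c i x) * \<alpha> i) * monom_subst var m :: (gf2, 'v, 'a) rpoly)"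
        by (intro sum.cong refl) (simp only: ext_single hc mult_ac)
      also have "\<dots> = const x * monom_subst var m"
      proof -
        have "const (sum f A) = (\<Sum>i\<in>A. const (f i) :: (gf2, 'v, 'a) rpoly)" for f and A :: "'n set"
          by (induction A rule: infinite_finite_induct) (simp_all add: hc)
        from this[of "\<lambda>i. of_gf2 (c i x) * \<alpha> i" UNIV] show ?thesis
          unfolding c1[of x, symmetric] by (simp only: sum_distrib_right)
      qed
      finally show ?case unfolding abs_rpoly_single[of m x]
        by (intro exI[of _ "\<lambda>i. abs_rpoly (Poly_Mapping.single m (c i x))"]) (rule sym)
    next
      case (add p q)
      then obtain g g' where
        "abs_rpoly p = (\<Sum>i\<in>UNIV. extend_scalars (g i) * const (\<alpha> i) :: (gf2, 'v, 'a) rpoly)"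
        "abs_rpoly q = (\<Sum>i\<in>UNIV. extend_scalars (g' i) * const (\<alpha> i) :: (gf2, 'v, 'a) rpoly)"
        by blast
      then show ?case
        by (intro exI[of _ "\<lambda>i. g i + g' i"])
           (simp only: ext_add distrib_right sum.distrib flip: plus_rpoly.abs_eq)
    qed
  qed
  moreover have uniq: "g k = g' k"
    if eq: "(\<Sum>i\<in>UNIV. extend_scalars (g i) * const (\<alpha> i)) =
       (\<Sum>i\<in>UNIV. extend_scalars (g' i) * const (\<alpha> i) :: (gf2, 'v, 'a) rpoly)" for g g' k
  proof -
    have key: "\<exists>p. abs_rpoly p = (\<Sum>i\<in>UNIV. extend_scalars (g i) * const (\<alpha> i) :: (gf2, 'v, 'a) rpoly)
        \<and> D k p = g k" for g
    proof -
      obtain P where P: "\<And>i. abs_rpoly (P i) = (extend_scalars (g i) :: (gf2, 'v, 'a) rpoly)"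
        "\<And>i a k. D k (P i * Const a) = g i * const (c k a)"
      proof -
        have "\<exists>P. \<forall>i. abs_rpoly (P i) = (extend_scalars (g i) :: (gf2, 'v, 'a) rpoly) \<and>
            (\<forall>a k. D k (P i * Const a) = g i * const (c k a))"
          by (intro choice allI lift)
        then show ?thesis using that by blast
      qed
      have abs_sum: "abs_rpoly (sum f A) = (\<Sum>i\<in>A. abs_rpoly (f i) :: (gf2, 'v, 'a) rpoly)"
        for f and A :: "'n set"
        by (induction A rule: infinite_finite_induct)
           (simp_all only: sum.empty sum.infinite sum.insert zero_rpoly_def simp_thms
             flip: plus_rpoly.abs_eq)
      have D_sum: "D k (sum f A) = (\<Sum>i\<in>A. D k (f i))" for f and A :: "'n set"
        by (induction A rule: infinite_finite_induct) (simp_all only: sum.empty sum.infinite sum.insert D_0 D_add simp_thms)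
      have "abs_rpoly (\<Sum>i\<in>UNIV. P i * Const (\<alpha> i)) =
          (\<Sum>i\<in>UNIV. extend_scalars (g i) * const (\<alpha> i) :: (gf2, 'v, 'a) rpoly)"
        unfolding abs_sum
        by (intro sum.cong refl) (simp only: P(1) const.abs_eq flip: times_rpoly.abs_eq)
      moreover have "D k (\<Sum>i\<in>UNIV. P i * Const (\<alpha> i)) = (\<Sum>i\<in>UNIV. if i = k then g i else 0)"
        unfolding D_sum P(2) c_basis by (intro sum.cong refl) (auto simp: hc)
      ultimately show ?thesis
        by (intro exI[of _ "\<Sum>i\<in>UNIV. P i * Const (\<alpha> i)"])
           (simp only: sum.delta finite UNIV_I if_True simp_thms)
    qed
    obtain p p' where p: "abs_rpoly p = (abs_rpoly p' :: (gf2, 'v, 'a) rpoly)"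
      and D: "D k p = g k" "D k p' = g' k"
      using key[of g] key[of g'] eq by metis
    have "D k (p - p') = 0"
      using p by (intro D_ideal) (simp only: rpoly.abs_eq_iff red_rel_def)
    then show ?thesis by (simp only: D_diff D eq_iff_diff_eq_0[of "g k"])
  qed
  ultimately show ?thesis by (intro ex_ex1I ext, blast) (rule uniq, simp only:)
qed

definition weil_component ::
  "('n::finite \<Rightarrow> 'a::finite_field) \<Rightarrow> ('a, 2, 'a) rpoly \<Rightarrow> 'n \<Rightarrow> (gf2, 2 \<times> 'n, gf2) rpoly" where
  "weil_component \<alpha> f =
     (THE g. weil_subst \<alpha> f = (\<Sum>i\<in>UNIV. extend_scalars (g i) * const (\<alpha> i)))"


section \<open>Elliptic curves in Weierstrass form\<close>

record 'a weierstrass =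
  a1 :: 'a
  a2 :: 'a
  a3 :: 'a
  a4 :: 'a
  a6 :: 'a

definition b2 :: "'a::comm_ring_1 weierstrass \<Rightarrow> 'a" where
  "b2 E = a1 E ^ 2 + 4 * a2 E"

definition b4 :: "'a::comm_ring_1 weierstrass \<Rightarrow> 'a" where
  "b4 E = a1 E * a3 E + 2 * a4 E"

definition b6 :: "'a::comm_ring_1 weierstrass \<Rightarrow> 'a" where
  "b6 E = a3 E ^ 2 + 4 * a6 E"

definition b8 :: "'a::comm_ring_1 weierstrass \<Rightarrow> 'a" where
  "b8 E = a1 E ^ 2 * a6 E - a1 E * a3 E * a4 E + a2 E * a3 E ^ 2 + 4 * a2 E * a6 E - a4 E ^ 2"

text \<open>Nonsingularity of the equation, expressed by its discriminant.\<close>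

definition elliptic_curve :: "'a::field weierstrass \<Rightarrow> bool" where
  "elliptic_curve E \<longleftrightarrow>
     - (b2 E ^ 2) * b8 E - 8 * b4 E ^ 3 - 27 * b6 E ^ 2 + 9 * b2 E * b4 E * b6 E \<noteq> 0"

datatype 'a point = Infinity | Affine (xcoord: 'a) (ycoord: 'a)

definition points :: "'a::field weierstrass \<Rightarrow> 'a point set" where
  "points E = insert Infinity
     {Affine x y | x y. y ^ 2 + a1 E * x * y + a3 E * y = x ^ 3 + a2 E * x ^ 2 + a4 E * x + a6 E}"

text \<open>The chord-tangent group law: \<open>y = l * x + m\<close> is the line through the two points,
  respectively the tangent line if they coincide.\<close>

fun point_add :: "'a::field weierstrass \<Rightarrow> 'a point \<Rightarrow> 'a point \<Rightarrow> 'a point" where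
  "point_add E Infinity Q = Q"
| "point_add E P Infinity = P"
| "point_add E (Affine x1 y1) (Affine x2 y2) =
     (if x1 = x2 \<and> y1 + y2 + a1 E * x2 + a3 E = 0 then Infinity
      else
        let l = (if x1 = x2
                 then (3 * x1 ^ 2 + 2 * a2 E * x1 + a4 E - a1 E * y1) / (2 * y1 + a1 E * x1 + a3 E)
                 else (y2 - y1) / (x2 - x1));
            m = y1 - l * x1;
            x3 = l ^ 2 + a1 E * l - a2 E - x1 - x2
        in Affine x3 (- (l + a1 E) * x3 - m - a3 E))"

definition two_torsion :: "'a::field weierstrass \<Rightarrow> 'a point set" where
  "two_torsion E = {P \<in> points E. point_add E P P = Infinity}"

definition summation_poly :: "'a::comm_ring_1 weierstrass \<Rightarrow> (3, 'a) mpoly" where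
  "summation_poly E = (let X1 = Var 1; X2 = Var 2; X3 = Var 3 in
     (X1 ^ 2 * X2 ^ 2 + X1 ^ 2 * X3 ^ 2 + X2 ^ 2 * X3 ^ 2)
     - 2 * (X1 ^ 2 * X2 * X3 + X1 * X2 ^ 2 * X3 + X1 * X2 * X3 ^ 2)
     - Const (b2 E) * X1 * X2 * X3
     - Const (b4 E) * (X1 * X2 + X1 * X3 + X2 * X3)
     - Const (b6 E) * (X1 + X2 + X3)
     - Const (b8 E))"

text \<open>The class of \<open>S(X\<^sub>1, X\<^sub>2, c)\<close>.\<close>

definition summation_at :: "'a::finite_field weierstrass \<Rightarrow> 'a \<Rightarrow> ('a, 2, 'a) rpoly" where
  "summation_at E c = mpoly_subst const
     (\<lambda>i. if i = 1 then var 1 else if i = 2 then var 2 else const c) (summation_poly E)"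

end

theory Submission
  imports Defs
begin

text \<open>Put \<open>u = (X\<^sub>1 X\<^sub>2 + x (X\<^sub>1 + X\<^sub>2)) / b\<close> and \<open>v = (a\<^sub>1 y + a\<^sub>4) / b\<close>, where \<open>P = (x, y)\<close>. In
  characteristic two the equation of the curve gives
  \<open>S(X\<^sub>1, X\<^sub>2, x) / b\<^sup>2 = (u\<^sup>2 + u) + (v\<^sup>2 + v) + (x + a\<^sub>2) / a\<^sub>1\<^sup>2 + (X\<^sub>1 + X\<^sub>2) / a\<^sub>1\<^sup>2\<close>. In
  \<open>F[X\<^sub>i\<^sub>j]\<close> modulo the \<open>X\<^sub>i\<^sub>j\<^sup>2 - X\<^sub>i\<^sub>j\<close> every element satisfies \<open>r\<^bsup>2^n\<^esup> = r\<close>, so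
  \<open>r \<mapsto> r + r\<^sup>2 + \<dots> + r\<^bsup>2^(n-1)\<^esup>\<close> kills the Artin--Schreier terms \<open>u\<^sup>2 + u\<close> and \<open>v\<^sup>2 + v\<close>.
  Elements of \<open>R\<^sub>2\<close> are idempotent, so this map is \<open>R\<^sub>2\<close>-linear and extends the trace of \<open>F\<close>;
  applying it to the expansions in the basis yields the claim, first in the extension of scalars
  of \<open>R\<^sub>2\<close> and then, by injectivity, in \<open>R\<^sub>2\<close>.\<close>

section \<open>Homomorphisms of reduced polynomial rings\<close>

lemma coeff_hom_sum:
  assumes "coeff_hom \<phi>"
  shows "\<phi> (sum f A) = (\<Sum>i\<in>A. \<phi> (f i))"
  by (induction A rule: infinite_finite_induct) (simp_all add: coeff_homD[OF assms])

lemma coeff_hom_power: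
  assumes "coeff_hom \<phi>"
  shows "\<phi> (x ^ k) = \<phi> x ^ k"
  by (induction k) (simp_all add: coeff_homD[OF assms])

lemma coeff_hom_diff:
  assumes "coeff_hom \<phi>"
  shows "\<phi> (x - y) = \<phi> x - \<phi> y"
  using coeff_homD(3)[OF assms, of "x - y" y] by simp

lemma coeff_hom_rpoly_subst:
  fixes \<phi> :: "'k::comm_ring_1 \<Rightarrow> 'r::comm_ring_1"
  assumes "coeff_hom \<phi>" "\<And>v. f v ^ CARD('q) = f v"
  shows "coeff_hom (rpoly_subst \<phi> f :: ('q, 'v, 'k) rpoly \<Rightarrow> 'r)"
  unfolding coeff_hom_def
proof (intro conjI allI)
  note s = rpoly_subst_abs[where 'q = 'q, OF assms]
  show "rpoly_subst \<phi> f (1 :: ('q, 'v, 'k) rpoly) = 1"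
    using rpoly_subst_const[where 'q = 'q, OF assms, where c = 1]
    by (simp add: coeff_homD[OF coeff_hom_const] coeff_homD[OF assms(1)])
  fix F G :: "('q, 'v, 'k) rpoly"
  show "rpoly_subst \<phi> f (F + G) = rpoly_subst \<phi> f F + rpoly_subst \<phi> f G"
    by (induction F rule: rpoly.abs_induct, induction G rule: rpoly.abs_induct)
      (simp only: plus_rpoly.abs_eq s mpoly_subst_add[OF assms(1)])
  show "rpoly_subst \<phi> f (F * G) = rpoly_subst \<phi> f F * rpoly_subst \<phi> f G"
    by (induction F rule: rpoly.abs_induct, induction G rule: rpoly.abs_induct)
      (simp only: times_rpoly.abs_eq s mpoly_subst_mult[OF assms(1)])
qed

lemma coeff_hom_weil_subst: "coeff_hom (weil_subst \<alpha>)"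
  unfolding weil_subst_def[abs_def]
  by (intro coeff_hom_rpoly_subst coeff_hom_const weil_sum_power_card)

lemma coeff_hom_extend_scalars:
  assumes "CHAR('a::finite_field) = 2"
  shows "coeff_hom (extend_scalars :: (gf2, 'v, gf2) rpoly \<Rightarrow> (gf2, 'v, 'a) rpoly)"
  unfolding extend_scalars_def[abs_def]
  by (intro coeff_hom_rpoly_subst coeff_hom_const_of_gf2 assms var_power_card)

lemma extend_scalars_const:
  assumes "CHAR('a::finite_field) = 2"
  shows "(extend_scalars (const c) :: (gf2, 'v, 'a) rpoly) = const (of_gf2 c)"
  unfolding extend_scalars_def
  by (intro rpoly_subst_const coeff_hom_const_of_gf2 assms var_power_card)

lemma extend_scalars_var:
  assumes "CHAR('a::finite_field) = 2"
  shows "(extend_scalars (var v) :: (gf2, 'v, 'a) rpoly) = var v"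
  unfolding extend_scalars_def
  by (intro rpoly_subst_var coeff_hom_const_of_gf2 assms var_power_card)

text \<open>The constant families \<open>g\<close> and \<open>g'\<close> are coordinate families of
  one and the same element, so uniqueness of coordinates applies.\<close>

lemma extend_scalars_inject:
  fixes g g' :: "(gf2, 'v, gf2) rpoly" and \<alpha> :: "'n::finite \<Rightarrow> 'a::finite_field"
  assumes "CHAR('a) = 2" "gf2_basis \<alpha>"
    and "(extend_scalars g :: (gf2, 'v, 'a) rpoly) = extend_scalars g'"
  shows "g = g'"
proof -
  have "(\<lambda>_::'n. g) = (\<lambda>_. g')"
    using ex1_weil_component[OF assms(1,2), of "\<Sum>i\<in>UNIV. extend_scalars g * const (\<alpha> i)"] assms(3)
    by auto
  then show ?thesis by metis
qed

lemma weil_component_sum: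
  fixes \<alpha> :: "'n::finite \<Rightarrow> 'a::finite_field"
  assumes "CHAR('a) = 2" "gf2_basis \<alpha>"
  shows "(\<Sum>i\<in>UNIV. extend_scalars (weil_component \<alpha> f i) * const (\<alpha> i)) = weil_subst \<alpha> f"
  using theI'[OF ex1_weil_component[OF assms, of "weil_subst \<alpha> f"]]
  unfolding weil_component_def by (rule sym)


section \<open>Powers of two in characteristic two\<close>

lemma power2_add_char2:
  fixes x y :: "'r::comm_ring_1"
  assumes "(2::'r) = 0"
  shows "(x + y) ^ 2 = x ^ 2 + y ^ 2"
  by (simp add: power2_sum assms)

lemma power_two_power_add:
  fixes x y :: "'r::comm_ring_1"
  assumes "(2::'r) = 0"
  shows "(x + y) ^ (2 ^ k) = x ^ (2 ^ k) + y ^ (2 ^ k)"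
proof (induction k)
  case (Suc k)
  then show ?case by (simp only: power_Suc2 power_mult power2_add_char2[OF assms])
qed simp

lemma power_two_power_sum:
  fixes f :: "'i \<Rightarrow> 'r::comm_ring_1"
  assumes "(2::'r) = 0"
  shows "sum f A ^ (2 ^ k) = (\<Sum>i\<in>A. f i ^ (2 ^ k))"
  by (induction A rule: infinite_finite_induct)
    (simp_all add: power_two_power_add[OF assms] zero_power)

lemma const_two_eq_0:
  assumes "(2::'k::comm_ring_1) = 0"
  shows "(2::('q, 'v, 'k) rpoly) = 0"
proof -
  note h = coeff_homD[OF coeff_hom_const[where 'q = 'q and 'v = 'v and 'k = 'k]]
  have "(1::('q, 'v, 'k) rpoly) + 1 = const (1 + 1)"
    by (simp only: h)
  then show ?thesis by (simp only: one_add_one assms h)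
qed

lemma gf2_two_eq_0: "(2::gf2) = 0"
  by (simp only: flip: one_add_one) (transfer, simp)

lemma CHAR_2_two_eq_0:
  assumes "CHAR('a::comm_ring_1) = 2"
  shows "(2::'a) = 0"
  using of_nat_CHAR[where 'a = 'a] by (simp only: assms of_nat_numeral)

text \<open>Squaring is additive in characteristic two, so single terms suffice; there the
  coefficient and every variable are idempotent.\<close>

lemma idempotent_gf2_rpoly: "(g :: (gf2, 'v, gf2) rpoly) ^ 2 = g"
proof (induction g rule: rpoly.abs_induct)
  fix p :: "('v, gf2) mpoly"
  note h = coeff_homD[OF coeff_hom_const[where 'q = gf2 and 'v = 'v and 'k = gf2]]
  show "(abs_rpoly p :: (gf2, 'v, gf2) rpoly) ^ 2 = abs_rpoly p"
  proof (induction p rule: mpoly_induct)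
    case (single m c)
    have c: "c ^ 2 = c" using gf2_cases[of c] by auto
    have v: "(var v ^ k) ^ 2 = (var v ^ k :: (gf2, 'v, gf2) rpoly)" for v k
      using var_power_card[where 'q = gf2 and v = v and 'k = gf2]
      by (simp only: CARD_gf2 power_mult[symmetric] mult.commute[of k 2]) (simp only: power_mult)
    show ?case
      by (simp only: abs_rpoly_single monom_subst_def power_mult_distrib prod_power_distrib
          const_power[symmetric] c v)
  next
    case (add p q)
    then show ?case
      by (simp only: power2_add_char2[OF const_two_eq_0[OF gf2_two_eq_0]] flip: plus_rpoly.abs_eq)
  qed
qed

lemma idempotent_power_two_power:
  fixes x :: "'r::comm_ring_1"
  assumes "x ^ 2 = x"
  shows "x ^ (2 ^ k) = x"
  by (induction k) (simp_all only: power_Suc2 power_mult power_0 power_one_right assms)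


section \<open>The trace of a reduced polynomial\<close>

text \<open>Stated over an arbitrary commutative ring because it is applied to reduced polynomials;
  on constants it gives the field trace.\<close>

definition trace_sum :: "nat \<Rightarrow> 'r::comm_ring_1 \<Rightarrow> 'r" where
  "trace_sum n x = (\<Sum>k<n. x ^ (2 ^ k))"

lemma trace_sum_add:
  fixes x y :: "'r::comm_ring_1"
  assumes "(2::'r) = 0"
  shows "trace_sum n (x + y) = trace_sum n x + trace_sum n y"
  by (simp add: trace_sum_def power_two_power_add[OF assms] sum.distrib)

lemma trace_sum_sum:
  fixes f :: "'i \<Rightarrow> 'r::comm_ring_1"
  assumes "(2::'r) = 0"
  shows "trace_sum n (sum f A) = (\<Sum>i\<in>A. trace_sum n (f i))"
  unfolding trace_sum_def power_two_power_sum[OF assms] by (rule sum.swap)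

lemma trace_sum_idempotent_mult:
  fixes e :: "'r::comm_ring_1"
  assumes "e ^ 2 = e"
  shows "trace_sum n (e * x) = e * trace_sum n x"
  by (simp only: trace_sum_def power_mult_distrib idempotent_power_two_power[OF assms]
      sum_distrib_left)

text \<open>Squaring permutes the summands cyclically, so \<open>x ^ 2\<close> and \<open>x\<close>
  have the same \<open>trace_sum\<close>, and the two cancel.\<close>

lemma trace_sum_power2_add:
  fixes x :: "'r::comm_ring_1"
  assumes "(2::'r) = 0" "x ^ (2 ^ n) = x"
  shows "trace_sum n (x ^ 2 + x) = 0"
proof -
  \<comment> \<open>Both sides are the sum of \<open>x ^ (2 ^ k)\<close> over \<open>k\<close> from
    0 to \<open>n\<close>; the final \<open>x\<close> on the right is
    \<open>x ^ (2 ^ n)\<close>.\<close>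
  have "trace_sum n (x ^ 2) + x = trace_sum n x + x"
    using sum.lessThan_Suc_shift[of "\<lambda>k. x ^ (2 ^ k)" n] assms(2)
    by (simp only: trace_sum_def power_mult[symmetric] power_Suc[symmetric] sum.lessThan_Suc
        power_0 power_one_right add.commute)
  then have "trace_sum n (x ^ 2 + x) = 2 * trace_sum n x"
    by (simp add: trace_sum_add[OF assms(1)])
  then show ?thesis by (simp add: assms(1))
qed

lemma trace_sum_const:
  fixes x :: "'a::finite_field"
  assumes "CARD('a) = 2 ^ n"
  shows "trace_sum n (const x) = (const (of_gf2 (gf2_trace x)) :: ('q, 'v, 'a) rpoly)"
  by (simp only: trace_sum_def of_gf2_gf2_trace[OF assms] const_power
      coeff_hom_sum[OF coeff_hom_const])

text \<open>The image of \<open>g\<close> is idempotent and so factors out like a scalar; the trace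
  of the remaining constant lies in the field with two elements.\<close>

lemma trace_sum_extend_scalars_mult:
  fixes x :: "'a::finite_field" and g :: "(gf2, 'v, gf2) rpoly"
  assumes "CARD('a) = 2 ^ n"
  shows "trace_sum n (extend_scalars g * const x) =
    (extend_scalars (const (gf2_trace x) * g) :: (gf2, 'v, 'a) rpoly)"
proof -
  have char: "CHAR('a) = 2" by (rule CHAR_eq_2[OF assms])
  note h = coeff_hom_extend_scalars[OF char, where 'v = 'v]
  have "extend_scalars g ^ 2 = (extend_scalars g :: (gf2, 'v, 'a) rpoly)"
    by (simp only: idempotent_gf2_rpoly flip: coeff_hom_power[OF h])
  then have "trace_sum n (extend_scalars g * const x) =
      (extend_scalars g * const (of_gf2 (gf2_trace x)) :: (gf2, 'v, 'a) rpoly)"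
    by (simp only: trace_sum_idempotent_mult trace_sum_const[OF assms])
  then show ?thesis
    by (simp only: coeff_homD(4)[OF h] extend_scalars_const[OF char] mult.commute)
qed

text \<open>The power acts termwise on the basis expansion: it fixes the coordinates by idempotence
  and the constants by Fermat's theorem for finite fields.\<close>

lemma power_card_extended_rpoly:
  fixes r :: "(gf2, 'v, 'a::finite_field) rpoly" and \<alpha> :: "'n::finite \<Rightarrow> 'a"
  assumes card: "CARD('a) = 2 ^ n" and basis: "gf2_basis \<alpha>"
  shows "r ^ (2 ^ n) = r"
proof -
  have char: "CHAR('a) = 2" by (rule CHAR_eq_2[OF card])
  obtain g where g: "r = (\<Sum>i\<in>UNIV. extend_scalars (g i) * const (\<alpha> i))"
    using ex1_weil_component[OF char basis, of r] by blast
  have e: "extend_scalars h ^ 2 = (extend_scalars h :: (gf2, 'v, 'a) rpoly)" for h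
    by (simp only: idempotent_gf2_rpoly flip: coeff_hom_power[OF coeff_hom_extend_scalars[OF char]])
  have a: "x ^ (2 ^ n) = x" for x :: 'a
    using finite_field_power_card_eq_same[of x] by (simp only: card)
  show ?thesis
    unfolding g power_two_power_sum[OF const_two_eq_0[OF CHAR_2_two_eq_0[OF char]]]
    by (simp only: power_mult_distrib idempotent_power_two_power[OF e] a flip: const_power)
qed


section \<open>The summation polynomial in characteristic two\<close>

text \<open>Both substitutions are ring homomorphisms, so they act term by term; the bracket with
  coefficient 2 vanishes.\<close>

lemma weil_subst_summation_at:
  fixes E :: "'a::finite_field weierstrass" and \<alpha> :: "'n::finite \<Rightarrow> 'a"
  defines "Z \<equiv> \<lambda>i. \<Sum>j\<in>UNIV. var (i, j) * const (\<alpha> j) :: (gf2, 2 \<times> 'n, 'a) rpoly"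
  assumes char: "CHAR('a) = 2"
  shows "weil_subst \<alpha> (summation_at E c) =
    Z 1 ^ 2 * Z 2 ^ 2 + Z 1 ^ 2 * const c ^ 2 + Z 2 ^ 2 * const c ^ 2
    - const (b2 E) * Z 1 * Z 2 * const c
    - const (b4 E) * (Z 1 * Z 2 + Z 1 * const c + Z 2 * const c)
    - const (b6 E) * (Z 1 + Z 2 + const c)
    - const (b8 E)"
proof -
  note hw = coeff_hom_weil_subst[of \<alpha>]
  have wvar: "weil_subst \<alpha> (var i) = Z i" for i
    unfolding weil_subst_def Z_def
    by (intro rpoly_subst_var coeff_hom_const weil_sum_power_card)
  have wconst: "weil_subst \<alpha> (const c) = const c" for c
    unfolding weil_subst_def by (intro rpoly_subst_const coeff_hom_const weil_sum_power_card)
  note two = const_two_eq_0[OF CHAR_2_two_eq_0[OF char]]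
  note hc = coeff_hom_const
  have m1: "mpoly_subst const f (1 :: (3, 'a) mpoly) = 1" for f :: "3 \<Rightarrow> ('a, 2, 'a) rpoly"
    using mpoly_subst_power[OF hc, of f 0 0] by simp
  have m2: "mpoly_subst const f (2 :: (3, 'a) mpoly) = 0" for f :: "3 \<Rightarrow> ('a, 2, 'a) rpoly"
    using mpoly_subst_add[OF hc, of f 1 1] by (simp only: one_add_one m1 two)
  \<comment> \<open>These decide the case distinction in \<open>summation_at\<close>, which sends
    the third variable to \<open>const c\<close>.\<close>
  have n: "(2::3) \<noteq> 1" "(3::3) \<noteq> 1" "(3::3) \<noteq> 2" by simp_all
  show ?thesis
    unfolding summation_at_def summation_poly_def Let_def
    by (simp only: mpoly_subst_diff[OF hc] mpoly_subst_add[OF hc] mpoly_subst_mult[OF hc]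
        mpoly_subst_power[OF hc] mpoly_subst_Var[OF hc] mpoly_subst_Const[OF hc] m2 n if_True
        if_False refl coeff_hom_diff[OF hw] wvar wconst coeff_homD[OF hw] coeff_hom_power[OF hw]
        mult_zero_left diff_zero)
qed

text \<open>Here \<open>w = 1 / b\<close> and \<open>d = 1 / a\<^sub>1\<close>.\<close>

lemma summation_artin_schreier:
  fixes a1 a2 a3 a4 a6 x y X1 X2 w d :: "'r::comm_ring_1"
  assumes two: "(2::'r) = 0"
    and curve: "y ^ 2 + a1 * x * y + a3 * y = x ^ 3 + a2 * x ^ 2 + a4 * x + a6"
    and w: "a1 * (a1 * x + a3) * w = 1" and d: "a1 * d = 1"
  shows "w ^ 2 * (X1 ^ 2 * X2 ^ 2 + X1 ^ 2 * x ^ 2 + X2 ^ 2 * x ^ 2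
    - a1 ^ 2 * X1 * X2 * x - a1 * a3 * (X1 * X2 + X1 * x + X2 * x)
    - a3 ^ 2 * (X1 + X2 + x)
    - (a1 ^ 2 * a6 - a1 * a3 * a4 + a2 * a3 ^ 2 - a4 ^ 2)) =
   ((w * (X1 * X2 + x * (X1 + X2))) ^ 2 + w * (X1 * X2 + x * (X1 + X2)))
   + ((w * (a1 * y + a4)) ^ 2 + w * (a1 * y + a4))
   + d ^ 2 * (x + a2) + d ^ 2 * (X1 + X2)"
    (is "w ^ 2 * ?S = ((w * ?U) ^ 2 + w * ?U) + ((w * ?V) ^ 2 + w * ?V) + _ + _")
proof -
  \<comment> \<open>Since \<open>w\<close> inverts \<open>a1 * c\<close>, the factor
    \<open>w ^ 2\<close> can be pulled out of the linear terms and of \<open>d ^ 2\<close> alike,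
    which leaves a polynomial identity.\<close>
  define c where "c = a1 * x + a3"
  have d': "d = w * c"
  proof -
    have "d = (a1 * c * w) * d" using w by (simp add: c_def)
    also have "\<dots> = w * c * (a1 * d)" by (simp only: mult_ac)
    finally show ?thesis using d by simp
  qed
  have lin: "w * z = w ^ 2 * (a1 * c * z)" for z
  proof -
    have "w ^ 2 * (a1 * c * z) = (a1 * c * w) * (w * z)"
      by (simp only: power2_eq_square mult_ac)
    then show ?thesis using w by (simp add: c_def)
  qed
  \<comment> \<open>Eliminating \<open>a6\<close> builds the curve equation into that
    identity.\<close>
  have a6: "a6 = y ^ 2 + a1 * x * y + a3 * y - (x ^ 3 + a2 * x ^ 2 + a4 * x)"
    by (simp only: curve add_diff_cancel_left')
  \<comment> \<open>The multiple of 2 is the difference of the two sides computed over the integers;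
    \<open>ideal.scale_scale\<close> would make the simplifier loop against \<open>mult.assoc\<close>.\<close>
  have "?S = ?U ^ 2 + a1 * c * ?U + ?V ^ 2 + a1 * c * ?V + c ^ 2 * (x + a2) + c ^ 2 * (X1 + X2)
     - 2 * (a1^2*x*X1*X2 + a1*a3*X1*X2 + 2*a1*a3*x*X1 + 2*a1*a3*x*X2 + a3^2*X1 + a3^2*X2 + a3^2*x
       + a1^2*y^2 + a1^3*x*y + a1^2*a3*y + a2*a3^2 + x*X1^2*X2 + x*X1*X2^2 + x^2*X1*X2
       + a1^2*x^2*X1 + a1^2*x^2*X2 + a1*a4*y + a1*a3*x^2 + a1*a2*a3*x)"
    unfolding a6 c_def
    by (simp add: algebra_simps power2_eq_square power3_eq_cube del: ideal.scale_scale)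
  then have "?S = ?U ^ 2 + a1 * c * ?U + ?V ^ 2 + a1 * c * ?V + c ^ 2 * (x + a2) + c ^ 2 * (X1 + X2)"
    by (simp only: two mult_zero_left diff_zero)
  then have "w ^ 2 * ?S = w ^ 2 * \<dots>" by (simp only:)
  also have "\<dots> = (w ^ 2 * ?U ^ 2 + w ^ 2 * (a1 * c * ?U)) + (w ^ 2 * ?V ^ 2 + w ^ 2 * (a1 * c * ?V))
     + (w * c) ^ 2 * (x + a2) + (w * c) ^ 2 * (X1 + X2)"
    by (simp only: distrib_left power_mult_distrib mult.assoc add.assoc)
  finally show ?thesis
    by (simp only: lin[symmetric] d'[symmetric] power_mult_distrib[of w])
qed

section \<open>Taking traces and descending to \<open>R\<^sub>2\<close>\<close>

theorem corollary4p11: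
  fixes E :: "'a::finite_field weierstrass"
    and P :: "'a point"
    and \<alpha> :: "'n::finite \<Rightarrow> 'a"
    and T :: "('a, 2, 'a) rpoly"
    and b :: 'a
  assumes "CARD('a) = 2 ^ CARD('n)"
    and "elliptic_curve E"
    and "a1 E \<noteq> 0"
    and "P \<in> points E - two_torsion E"
    and "T = summation_at E (xcoord P)"
    and "b = a1 E * (a1 E * xcoord P + a3 E)"
    and "gf2_basis \<alpha>"
  shows "b \<noteq> 0 \<and>
    (\<Sum>j\<in>UNIV. const (gf2_trace (\<alpha> j / b ^ 2)) * weil_component \<alpha> T j) =
      const (gf2_trace ((xcoord P + a2 E) / a1 E ^ 2)) +
      (\<Sum>j\<in>UNIV. const (gf2_trace (\<alpha> j / a1 E ^ 2)) * (var (1, j) + var (2, j)))"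
proof
  let ?n = "CARD('n)"
  note card = assms(1) and basis = assms(7)
  have char: "CHAR('a) = 2" by (rule CHAR_eq_2[OF card])
  note twoa = CHAR_2_two_eq_0[OF char]
  note two = const_two_eq_0[OF twoa, where 'q = gf2 and 'v = "2 \<times> 'n"]
  \<comment> \<open>\<open>Infinity\<close> doubles to itself, so \<open>P\<close> is affine; the
    doubling formula yields \<open>Infinity\<close> exactly when the expression in
    \<open>tors\<close> vanishes.\<close>
  obtain x y where P: "P = Affine x y"
    and curve: "y ^ 2 + a1 E * x * y + a3 E * y = x ^ 3 + a2 E * x ^ 2 + a4 E * x + a6 E"
    and tors: "y + y + a1 E * x + a3 E \<noteq> 0"
    using assms(4) unfolding points_def two_torsion_def
    by (cases P) (auto split: if_splits simp flip: mult_2)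
  have "y + y = 0" using twoa by (simp flip: mult_2)
  then have "a1 E * x + a3 E \<noteq> 0" using tors by (simp only: add_0_left simp_thms)
  then show b0: "b \<noteq> 0" using assms(3,6) by (simp add: P)

  define Z :: "2 \<Rightarrow> (gf2, 2 \<times> 'n, 'a) rpoly"
    where "Z i = (\<Sum>j\<in>UNIV. var (i, j) * const (\<alpha> j))" for i
  let ?c = "const :: 'a \<Rightarrow> (gf2, 2 \<times> 'n, 'a) rpoly"
  let ?e = "extend_scalars :: (gf2, 2 \<times> 'n, gf2) rpoly \<Rightarrow> (gf2, 2 \<times> 'n, 'a) rpoly"
  let ?tr = "trace_sum ?n :: (gf2, 2 \<times> 'n, 'a) rpoly \<Rightarrow> _"
  note he = coeff_hom_extend_scalars[OF char, where 'v = "2 \<times> 'n"]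
  have hc: "?c (s + t) = ?c s + ?c t" "?c (s * t) = ?c s * ?c t" "?c (s ^ k) = ?c s ^ k"
    "?c (s - t) = ?c s - ?c t" "?c 1 = 1" for s t k
    by (simp_all only: coeff_homD[OF coeff_hom_const] coeff_hom_diff[OF coeff_hom_const] const_power)
  define w where "w = inverse b"
  define d where "d = inverse (a1 E)"
  define u where "u = ?c w * (Z 1 * Z 2 + ?c x * (Z 1 + Z 2))"
  define v where "v = ?c w * (?c (a1 E) * ?c y + ?c (a4 E))"
  have four: "(4::'a) = 0" using twoa by (metis numeral_Bit0 add_0_right)
  have bs: "b2 E = a1 E ^ 2" "b4 E = a1 E * a3 E" "b6 E = a3 E ^ 2"
    "b8 E = a1 E ^ 2 * a6 E - a1 E * a3 E * a4 E + a2 E * a3 E ^ 2 - a4 E ^ 2"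
    by (simp_all only: b2_def b4_def b6_def b8_def twoa four mult_zero_left add_0_right)
  have "?c w ^ 2 * weil_subst \<alpha> T =
      (u ^ 2 + u) + (v ^ 2 + v) + ?c d ^ 2 * (?c x + ?c (a2 E)) + ?c d ^ 2 * (Z 1 + Z 2)"
    unfolding assms(5) P point.sel weil_subst_summation_at[OF char] u_def v_def
      Z_def[symmetric] bs hc
  proof (rule summation_artin_schreier[OF two])
    show "?c y ^ 2 + ?c (a1 E) * ?c x * ?c y + ?c (a3 E) * ?c y =
      ?c x ^ 3 + ?c (a2 E) * ?c x ^ 2 + ?c (a4 E) * ?c x + ?c (a6 E)"
      using arg_cong[OF curve, of ?c] by (simp only: hc)
    show "?c (a1 E) * (?c (a1 E) * ?c x + ?c (a3 E)) * ?c w = 1"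
      unfolding w_def hc[symmetric] using right_inverse[OF b0] assms(6) by (simp only: P point.sel)
    show "?c (a1 E) * ?c d = 1"
      using assms(3) by (simp add: d_def flip: hc)
  qed
  then have "?tr (?c w ^ 2 * weil_subst \<alpha> T) =
      ?tr (?c d ^ 2 * (?c x + ?c (a2 E))) + ?tr (?c d ^ 2 * (Z 1 + Z 2))"
    using trace_sum_power2_add[OF two power_card_extended_rpoly[OF card basis], of u]
      trace_sum_power2_add[OF two power_card_extended_rpoly[OF card basis], of v]
    by (simp only: trace_sum_add[OF two] add_0_left)
  moreover have "?tr (?c w ^ 2 * weil_subst \<alpha> T) =
      ?e (\<Sum>j\<in>UNIV. const (gf2_trace (\<alpha> j / b ^ 2)) * weil_component \<alpha> T j)"
  proof -
    \<comment> \<open>The factor \<open>1 / b ^ 2\<close> is absorbed into the constants, so the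
      coordinates in \<open>R\<^sub>2\<close> stay unchanged.\<close>
    have "?c w ^ 2 * weil_subst \<alpha> T =
        (\<Sum>j\<in>UNIV. ?e (weil_component \<alpha> T j) * ?c (\<alpha> j / b ^ 2))"
      unfolding weil_component_sum[OF char basis, symmetric] sum_distrib_left
      by (intro sum.cong refl) (simp add: w_def power_inverse divide_inverse mult_ac flip: hc)
    then show ?thesis
      by (simp only: trace_sum_sum[OF two] trace_sum_extend_scalars_mult[OF card]
          coeff_hom_sum[OF he])
  qed
  moreover have "?tr (?c d ^ 2 * (?c x + ?c (a2 E))) =
      ?e (const (gf2_trace ((xcoord P + a2 E) / a1 E ^ 2)))"
  proof -
    have "?c d ^ 2 * (?c x + ?c (a2 E)) = ?c ((x + a2 E) / a1 E ^ 2)"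
      by (simp add: d_def power_inverse divide_inverse mult.commute flip: hc)
    then show ?thesis
      by (simp only: P point.sel trace_sum_const[OF card] extend_scalars_const[OF char])
  qed
  moreover have "?tr (?c d ^ 2 * (Z 1 + Z 2)) =
      ?e (\<Sum>j\<in>UNIV. const (gf2_trace (\<alpha> j / a1 E ^ 2)) * (var (1, j) + var (2, j)))"
  proof -
    have "\<alpha> j / a1 E ^ 2 = d ^ 2 * \<alpha> j" for j
      by (simp add: d_def power_inverse divide_inverse)
    \<comment> \<open>The variables are images of variables of \<open>R\<^sub>2\<close>, so these
      terms too are an extended element times a constant.\<close>
    then have "?e (var (1, j) + var (2, j)) * ?c (\<alpha> j / a1 E ^ 2) =
        ?c d ^ 2 * (var (1, j) * ?c (\<alpha> j) + var (2, j) * ?c (\<alpha> j))" for j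
      by (simp only: coeff_homD(3)[OF he] extend_scalars_var[OF char] hc distrib_left
          distrib_right mult_ac)
    then have "?c d ^ 2 * (Z 1 + Z 2) =
        (\<Sum>j\<in>UNIV. ?e (var (1, j) + var (2, j)) * ?c (\<alpha> j / a1 E ^ 2))"
      by (simp only: Z_def sum_distrib_left flip: sum.distrib)
    then show ?thesis
      by (simp only: trace_sum_sum[OF two] trace_sum_extend_scalars_mult[OF card]
          coeff_hom_sum[OF he])
  qed
  ultimately show "(\<Sum>j\<in>UNIV. const (gf2_trace (\<alpha> j / b ^ 2)) * weil_component \<alpha> T j) =
      const (gf2_trace ((xcoord P + a2 E) / a1 E ^ 2)) +
      (\<Sum>j\<in>UNIV. const (gf2_trace (\<alpha> j / a1 E ^ 2)) * (var (1, j) + var (2, j)))"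
    by (intro extend_scalars_inject[OF char basis]) (simp only: coeff_homD(3)[OF he])
qed

end
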